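(* Let $\lambda,b_1,b_2\in\mathbb{R}$, let $r_a,r_b,r_c\ge0$, and let $$A=\begin{bmatrix}\lambda\mathbb{I}_2 & B & B^{\top} \\ B^{\top} & \lambda\mathbb{I}_2 & B \\ B & B^{\top} & \lambda\mathbb{I}_2\end{bmatrix}\in\mathbb{R}^{6\times6},\qquad B=\begin{bmatrix}b_1 & -b_2 \\ b_2 & b_1\end{bmatrix}.$$ Consider the quadratically constrained quadratic program in $x_{abc}=(x_a^{\top},x_b^{\top},x_c^{\top})^{\top}\in\mathbb{R}^6$ $$\max_{x_{abc}\in\partial\bar{D}(r_a)\times\partial\bar{D}(r_b)\times\partial\bar{D}(r_c)}x_{abc}^{\top}Ax_{abc}.$$ Then the following semidefinite relaxation, over real symmetric $6\times6$ matrices $X_{abc}$, is exact for this program (i.e., it has the same optimal value): $$\begin{aligned}\max\ &\operatorname{Tr}(AX_{abc})\\ \text{s.t. }&X_{abc,11}+X_{abc,22}=r_a^2,\\ &X_{abc,33}+X_{abc,44}=r_b^2,\\ &X_{abc,55}+X_{abc,66}=r_c^2,\\ &X_{abc}\succeq0.\end{aligned}$$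
   Context: $\mathbb{I}_2$ is the $2\times2$ identity matrix. $\bar{D}(r)=\{x\in\mathbb{R}^2:\|x\|\le r\}$ with $\|\cdot\|$ the Euclidean norm, and $\partial\bar{D}(r)=\{x\in\mathbb{R}^2:\|x\|=r\}$ is its boundary. A product of three subsets of $\mathbb{R}^2$ is regarded as a subset of $\mathbb{R}^6$. $X_{abc,ij}$ is the $(i,j)$ entry of $X_{abc}$, and $X\succeq0$ means positive semidefinite. Exactness means equality of optimal values. *)

theory Defs
  imports "HOL-Analysis.Analysis"
begin

(* In the index type 6 the numeral 6 denotes 0, so 1, ..., 6 are exactly its six elements;
   "vector" fills the positions 1, ..., 6 in this order. *)

definition stack3 :: "real^2 \<Rightarrow> real^2 \<Rightarrow> real^2 \<Rightarrow> real^6" where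
  "stack3 a b c = vector [a $ 1, a $ 2, b $ 1, b $ 2, c $ 1, c $ 2]"

definition block3 ::
  "real^2^2 \<Rightarrow> real^2^2 \<Rightarrow> real^2^2 \<Rightarrow>
   real^2^2 \<Rightarrow> real^2^2 \<Rightarrow> real^2^2 \<Rightarrow>
   real^2^2 \<Rightarrow> real^2^2 \<Rightarrow> real^2^2 \<Rightarrow> real^6^6" where
  "block3 P11 P12 P13 P21 P22 P23 P31 P32 P33 = vector
     [stack3 (P11 $ 1) (P12 $ 1) (P13 $ 1),
      stack3 (P11 $ 2) (P12 $ 2) (P13 $ 2),
      stack3 (P21 $ 1) (P22 $ 1) (P23 $ 1),
      stack3 (P21 $ 2) (P22 $ 2) (P23 $ 2),
      stack3 (P31 $ 1) (P32 $ 1) (P33 $ 1),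
      stack3 (P31 $ 2) (P32 $ 2) (P33 $ 2)]"

definition B_mat :: "real \<Rightarrow> real \<Rightarrow> real^2^2" where
  "B_mat b1 b2 = vector [vector [b1, - b2], vector [b2, b1]]"

definition A_mat :: "real \<Rightarrow> real \<Rightarrow> real \<Rightarrow> real^6^6" where
  "A_mat lam b1 b2 =
     (let L = lam *\<^sub>R mat 1; B = B_mat b1 b2; Bt = transpose B
      in block3 L  B  Bt
                Bt L  B
                B  Bt L)"

(* symmetry is part of the definition *)
definition psd :: "real^'n^'n \<Rightarrow> bool" where
  "psd X \<longleftrightarrow> transpose X = X \<and> (\<forall>v. 0 \<le> v \<bullet> (X *v v))"

definition qcqp_feasible :: "real \<Rightarrow> real \<Rightarrow> real \<Rightarrow> (real^6) set" where
  "qcqp_feasible ra rb rc =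
     {stack3 xa xb xc | xa xb xc. xa \<in> sphere 0 ra \<and> xb \<in> sphere 0 rb \<and> xc \<in> sphere 0 rc}"

definition sdp_feasible :: "real \<Rightarrow> real \<Rightarrow> real \<Rightarrow> (real^6^6) set" where
  "sdp_feasible ra rb rc =
     {X. X $ 1 $ 1 + X $ 2 $ 2 = ra\<^sup>2 \<and>
         X $ 3 $ 3 + X $ 4 $ 4 = rb\<^sup>2 \<and>
         X $ 5 $ 5 + X $ 6 $ 6 = rc\<^sup>2 \<and>
         psd X}"

(* an attained maximum; hence v is unique if it exists *)
definition is_max_value :: "('a \<Rightarrow> real) \<Rightarrow> 'a set \<Rightarrow> real \<Rightarrow> bool" where
  "is_max_value f S v \<longleftrightarrow> (\<exists>x\<in>S. f x = v) \<and> (\<forall>x\<in>S. f x \<le> v)"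

end

theory Submission
  imports Defs
begin

text \<open>Identify \<open>\<real>\<^sup>2\<close> with \<open>\<complex>\<close>, so that \<open>B\<close> acts as multiplication by \<open>\<beta> = b\<^sub>1 + i b\<^sub>2\<close>. A feasible \<open>X\<close>
  enters only through a positive semidefinite Hermitian 3 by 3 matrix with diagonal
  \<open>r\<^sub>a\<^sup>2, r\<^sub>b\<^sup>2, r\<^sub>c\<^sup>2\<close>. With two of its off-diagonal entries fixed, the third ranges over a disc, and
  moving it to the best boundary point makes the matrix a Gram matrix of three vectors of \<open>\<complex>\<^sup>2\<close>.
  In a suitable orthonormal basis of \<open>\<complex>\<^sup>2\<close> the first coordinates of these vectors have moduli
  proportional to \<open>r\<^sub>a, r\<^sub>b, r\<^sub>c\<close>, hence so do the second ones: the matrix is a convex combination of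
  two rank-one matrices that come from feasible points of the quadratic program.\<close>

section \<open>Vectors of dimension six\<close>

lemma exhaust_6: "(x::6) = 1 \<or> x = 2 \<or> x = 3 \<or> x = 4 \<or> x = 5 \<or> x = 6"
proof (induct x)
  case (of_int z)
  then have "z = 0 \<or> z = 1 \<or> z = 2 \<or> z = 3 \<or> z = 4 \<or> z = 5" by fastforce
  then show ?case by auto
qed

lemma UNIV_6: "(UNIV::6 set) = {1, 2, 3, 4, 5, 6}"
  using exhaust_6 by auto

lemma sum_6: "sum f (UNIV::6 set) = f 1 + f 2 + f 3 + f 4 + f 5 + f 6"
  unfolding UNIV_6 by (simp add: ac_simps)

lemma vector_6:
  "(vector [a,b,c,d,e,f] :: ('a::zero)^6) $ 1 = a"
  "(vector [a,b,c,d,e,f] :: ('a::zero)^6) $ 2 = b"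
  "(vector [a,b,c,d,e,f] :: ('a::zero)^6) $ 3 = c"
  "(vector [a,b,c,d,e,f] :: ('a::zero)^6) $ 4 = d"
  "(vector [a,b,c,d,e,f] :: ('a::zero)^6) $ 5 = e"
  "(vector [a,b,c,d,e,f] :: ('a::zero)^6) $ 6 = f"
  unfolding vector_def by simp_all

lemmas stack3_nth = vector_6[of "a $ 1" "a $ 2" "b $ 1" "b $ 2" "c $ 1" "c $ 2" for a b c :: "real^2",
    folded stack3_def]

lemma A_mat_rows:
  "A_mat lam b1 b2 $ 1 = vector [lam, 0, b1, - b2, b1, b2]"
  "A_mat lam b1 b2 $ 2 = vector [0, lam, b2, b1, - b2, b1]"
  "A_mat lam b1 b2 $ 3 = vector [b1, b2, lam, 0, b1, - b2]"
  "A_mat lam b1 b2 $ 4 = vector [- b2, b1, 0, lam, b2, b1]"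
  "A_mat lam b1 b2 $ 5 = vector [b1, - b2, b1, b2, lam, 0]"
  "A_mat lam b1 b2 $ 6 = vector [b2, b1, - b2, b1, 0, lam]"
  by (simp_all add: A_mat_def Let_def block3_def vector_6 stack3_def B_mat_def transpose_def mat_def)

section \<open>The problem in complex notation\<close>

definition cyc :: "complex \<Rightarrow> complex \<Rightarrow> complex \<Rightarrow> complex" where
  "cyc z1 z2 z3 = cnj z1 * z2 + cnj z2 * z3 + cnj z3 * z1"

lemma cyc_scaleR: "cyc (t *\<^sub>R z1) (t *\<^sub>R z2) (t *\<^sub>R z3) = t\<^sup>2 *\<^sub>R cyc z1 z2 z3"
  by (simp add: cyc_def algebra_simps power2_eq_square)

definition cplx :: "real^2 \<Rightarrow> complex" where
  "cplx v = Complex (v $ 1) (v $ 2)"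

lemma norm_cplx: "norm (cplx v) = norm v"
  by (simp add: cplx_def complex_norm norm_vec_def L2_set_def sum_2)

lemma surj_cplx: "surj cplx"
proof (rule surjI)
  show "cplx (vector [Re z, Im z]) = z" for z by (simp add: cplx_def)
qed

text \<open>For \<open>X = x x\<^sup>T\<close> with blocks \<open>z\<^sub>i\<close> these three numbers are \<open>cnj z\<^sub>a * z\<^sub>b\<close>, \<open>cnj z\<^sub>b * z\<^sub>c\<close>
  and \<open>cnj z\<^sub>c * z\<^sub>a\<close>: they are the off-diagonal entries of the Hermitian 3 by 3 matrix that
  averages \<open>X\<close> over simultaneous rotations of the three planes.\<close>

definition hab :: "real^6^6 \<Rightarrow> complex" where
  "hab X = Complex (X$1$3 + X$2$4) (X$1$4 - X$2$3)"

definition hbc :: "real^6^6 \<Rightarrow> complex" where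
  "hbc X = Complex (X$3$5 + X$4$6) (X$3$6 - X$4$5)"

definition hca :: "real^6^6 \<Rightarrow> complex" where
  "hca X = Complex (X$5$1 + X$6$2) (X$5$2 - X$6$1)"

lemma symmetric_nth:
  assumes "transpose X = X"
  shows "X $ i $ j = X $ j $ i"
  using assms by (metis transpose_def vec_lambda_beta)

text \<open>Each block of \<open>A_mat\<close> acts on \<complex> as multiplication by
  \<open>lam\<close>, \<open>Complex b1 b2\<close> or its conjugate. Symmetry of \<open>X\<close>
  pairs the blocks above and below the diagonal, whence the factor \<open>2\<close>.\<close>

lemma trace_A_mat:
  assumes "transpose X = X"
  shows "trace (A_mat lam b1 b2 ** X) =
    lam * ((X$1$1 + X$2$2) + (X$3$3 + X$4$4) + (X$5$5 + X$6$6))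
    + 2 * Re (Complex b1 b2 * (hab X + hbc X + hca X))"
proof -
  note s = symmetric_nth[OF assms]
  show ?thesis
    unfolding trace_def matrix_matrix_mult_def hab_def hbc_def hca_def
    by (simp add: sum_6 A_mat_rows vector_6 s[of 2 1] s[of 3 1] s[of 3 2] s[of 4 1] s[of 4 2]
        s[of 4 3] s[of 5 1] s[of 5 2] s[of 5 3] s[of 5 4] s[of 6 1] s[of 6 2] s[of 6 3]
        s[of 6 4] s[of 6 5] algebra_simps)
qed

lemma quadratic_form_A_mat:
  "stack3 a b c \<bullet> (A_mat lam b1 b2 *v stack3 a b c) =
    lam * ((norm a)\<^sup>2 + (norm b)\<^sup>2 + (norm c)\<^sup>2)
    + 2 * Re (Complex b1 b2 * cyc (cplx a) (cplx b) (cplx c))"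
proof -
  have n: "(norm v)\<^sup>2 = (v $ 1)\<^sup>2 + (v $ 2)\<^sup>2" for v :: "real^2"
    by (simp add: norm_vec_def L2_set_def sum_2)
  show ?thesis
    unfolding inner_vec_def matrix_vector_mult_def n
    by (simp add: sum_6 A_mat_rows vector_6 stack3_nth cyc_def cplx_def algebra_simps power2_eq_square)
qed

definition outer :: "real^'n \<Rightarrow> real^'n^'n" where
  "outer x = (\<chi> i j. x $ i * x $ j)"

lemma psd_outer: "psd (outer x)"
proof -
  have "v \<bullet> (outer x *v v) = (x \<bullet> v)\<^sup>2" for v
    by (simp add: outer_def inner_vec_def matrix_vector_mult_def power2_eq_square
        sum_product sum_distrib_left mult_ac)
  then show ?thesis
    by (simp add: psd_def) (simp add: outer_def transpose_def vec_eq_iff mult.commute)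
qed

lemma trace_outer: "trace (A ** outer x) = x \<bullet> (A *v x)"
  by (simp add: outer_def trace_def inner_vec_def matrix_vector_mult_def matrix_matrix_mult_def
        sum_distrib_left mult_ac)

lemma outer_sdp_feasible:
  assumes "x \<in> qcqp_feasible ra rb rc"
  shows "outer x \<in> sdp_feasible ra rb rc"
proof -
  obtain a b c where x: "x = stack3 a b c" and n: "norm a = ra" "norm b = rb" "norm c = rc"
    using assms by (auto simp: qcqp_feasible_def)
  have "(norm v)\<^sup>2 = v $ 1 * v $ 1 + v $ 2 * v $ 2" for v :: "real^2"
    by (simp add: norm_vec_def L2_set_def sum_2 power2_eq_square)
  then show ?thesis
    using psd_outer[of x] by (simp add: sdp_feasible_def outer_def x stack3_nth flip: n)
qed

text \<open>Positive semidefiniteness of the Hermitian matrix with diagonal \<open>A\<close>,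
  \<open>B\<close>, \<open>C\<close> and entries \<open>x\<close>, \<open>y\<close>,
  \<open>z\<close> at (1,2), (2,3), (3,1).\<close>

definition herm_nonneg ::
  "real \<Rightarrow> real \<Rightarrow> real \<Rightarrow> complex \<Rightarrow> complex \<Rightarrow> complex \<Rightarrow> bool" where
  "herm_nonneg A B C x y z \<longleftrightarrow> (\<forall>w1 w2 w3.
     0 \<le> (cmod w1)\<^sup>2 * A + (cmod w2)\<^sup>2 * B + (cmod w3)\<^sup>2 * C
       + 2 * Re (cnj w1 * w2 * x + cnj w2 * w3 * y + cnj w3 * w1 * z))"

text \<open>Blockwise \<open>u\<close> is \<open>cnj w\<close> and \<open>v\<close> is
  \<open>i * cnj w\<close>, that is, \<open>u\<close> turned by a right angle in each plane. Adding
  the two values of the form cancels the part of \<open>X\<close> that anticommutes with this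
  rotation.\<close>

lemma psd_imp_herm_nonneg:
  assumes "psd X"
  shows "herm_nonneg (X$1$1 + X$2$2) (X$3$3 + X$4$4) (X$5$5 + X$6$6) (hab X) (hbc X) (hca X)"
  unfolding herm_nonneg_def
proof (intro allI)
  fix w1 w2 w3 :: complex
  have "transpose X = X" using assms by (simp add: psd_def)
  note s = symmetric_nth[OF this]
  define u where "u = stack3 (vector [Re w1, - Im w1]) (vector [Re w2, - Im w2]) (vector [Re w3, - Im w3])"
  define v where "v = stack3 (vector [Im w1, Re w1]) (vector [Im w2, Re w2]) (vector [Im w3, Re w3])"
  have "0 \<le> u \<bullet> (X *v u) + v \<bullet> (X *v v)"
    using assms by (simp add: psd_def)
  also have "\<dots> = (cmod w1)\<^sup>2 * (X$1$1 + X$2$2) + (cmod w2)\<^sup>2 * (X$3$3 + X$4$4)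
      + (cmod w3)\<^sup>2 * (X$5$5 + X$6$6)
      + 2 * Re (cnj w1 * w2 * hab X + cnj w2 * w3 * hbc X + cnj w3 * w1 * hca X)"
    unfolding inner_vec_def matrix_vector_mult_def hab_def hbc_def hca_def u_def v_def cmod_power2
    by (simp add: sum_6 stack3_nth s[of 2 1] s[of 3 1] s[of 3 2] s[of 4 1] s[of 4 2]
        s[of 4 3] s[of 5 1] s[of 5 2] s[of 5 3] s[of 5 4] s[of 6 1] s[of 6 2] s[of 6 3]
        s[of 6 4] s[of 6 5] algebra_simps power2_eq_square)
  finally show "0 \<le> (cmod w1)\<^sup>2 * (X$1$1 + X$2$2) + (cmod w2)\<^sup>2 * (X$3$3 + X$4$4)
      + (cmod w3)\<^sup>2 * (X$5$5 + X$6$6)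
      + 2 * Re (cnj w1 * w2 * hab X + cnj w2 * w3 * hbc X + cnj w3 * w1 * hca X)" .
qed

section \<open>Reduction to rank two\<close>

lemma herm2_nonneg_imp:
  assumes *: "\<And>w1 w2. 0 \<le> (cmod w1)\<^sup>2 * A + (cmod w2)\<^sup>2 * B + 2 * Re (cnj w1 * w2 * d)"
  shows "0 \<le> A" "0 \<le> B" "(cmod d)\<^sup>2 \<le> A * B"
proof -
  show A: "0 \<le> A" using *[of 1 0] by simp
  show B: "0 \<le> B" using *[of 0 1] by simp
  \<comment> \<open>The test vector \<open>(d, - t)\<close> gives a real quadratic in
    \<open>t\<close>. For \<open>A > 0\<close> take \<open>t = A\<close>; for \<open>A = 0\<close>
    the values \<open>m / B\<close> or \<open>1\<close> force \<open>d = 0\<close>.\<close>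
  have t: "0 \<le> (cmod d)\<^sup>2 * A + t\<^sup>2 * B - 2 * t * (cmod d)\<^sup>2" for t :: real
  proof -
    have "Re (cnj d * of_real (- t) * d) = - t * (cmod d)\<^sup>2"
      unfolding cmod_power2 by (simp add: algebra_simps power2_eq_square)
    then show ?thesis using *[of d "of_real (- t)"] by (simp add: norm_mult)
  qed
  show "(cmod d)\<^sup>2 \<le> A * B"
  proof (cases "A = 0")
    case True
    have "(cmod d)\<^sup>2 \<le> 0"
    proof (cases "B = 0")
      case True
      then show ?thesis using t[of 1] \<open>A = 0\<close> by simp
    next
      case False
      then have "B > 0" using B by simp
      define m where "m = (cmod d)\<^sup>2"
      have "0 \<le> (m / B)\<^sup>2 * B - 2 * (m / B) * m"
        using t[of "m / B"] \<open>A = 0\<close> by (simp add: m_def)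
      also have "\<dots> = - (m\<^sup>2 / B)" using \<open>B > 0\<close> by (simp add: power2_eq_square field_simps)
      finally have "m\<^sup>2 \<le> 0" using \<open>B > 0\<close> by (simp add: divide_le_0_iff)
      then show ?thesis by (simp add: m_def)
    qed
    then show ?thesis using True by simp
  next
    case False
    then have "A > 0" using A by simp
    have "0 \<le> A * (A * B - (cmod d)\<^sup>2)"
      using t[of A] by (simp add: algebra_simps power2_eq_square)
    then show ?thesis using \<open>A > 0\<close> by (simp add: zero_le_mult_iff)
  qed
qed

text \<open>With \<open>(p3, q3) = (rc, 0)\<close> the vectors \<open>(pi, qi)\<close> reproduce
  \<open>y\<close> and \<open>z\<close> exactly; the second coordinates \<open>q1\<close>,
  \<open>q2\<close> remain to replace \<open>x\<close> by an entry at least as good.\<close>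

lemma herm_nonneg_rank_two:
  assumes H: "herm_nonneg (ra\<^sup>2) (rb\<^sup>2) (rc\<^sup>2) x y z"
  obtains p1 p2 p3 q1 q2 q3 where
    "(cmod p1)\<^sup>2 + (cmod q1)\<^sup>2 = ra\<^sup>2" "(cmod p2)\<^sup>2 + (cmod q2)\<^sup>2 = rb\<^sup>2"
    "(cmod p3)\<^sup>2 + (cmod q3)\<^sup>2 = rc\<^sup>2"
    "Re (\<beta> * (x + y + z)) \<le> Re (\<beta> * (cyc p1 p2 p3 + cyc q1 q2 q3))"
proof -
  have H': "0 \<le> (cmod w1)\<^sup>2 * ra\<^sup>2 + (cmod w2)\<^sup>2 * rb\<^sup>2 + (cmod w3)\<^sup>2 * rc\<^sup>2
       + 2 * Re (cnj w1 * w2 * x + cnj w2 * w3 * y + cnj w3 * w1 * z)" for w1 w2 w3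
    using H unfolding herm_nonneg_def by blast
  have y: "(cmod y)\<^sup>2 \<le> rb\<^sup>2 * rc\<^sup>2"
    using H'[of 0] by (intro herm2_nonneg_imp(3)) simp
  have z: "(cmod z)\<^sup>2 \<le> rc\<^sup>2 * ra\<^sup>2"
  proof (rule herm2_nonneg_imp(3))
    show "0 \<le> (cmod w)\<^sup>2 * rc\<^sup>2 + (cmod w')\<^sup>2 * ra\<^sup>2 + 2 * Re (cnj w * w' * z)" for w w'
      using H'[of w' 0 w] by simp
  qed
  define p1 where "p1 = z / of_real rc"
  define p2 where "p2 = cnj y / of_real rc"
  \<comment> \<open>If \<open>rc = 0\<close>, the bounds force \<open>y = z = 0\<close>, and both
    quotients are \<open>0\<close> by the convention on division by zero.\<close>
  have zp: "z = of_real rc * p1" and yp: "y = of_real rc * cnj p2"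
    using y z by (auto simp: p1_def p2_def)
  text \<open>Minimising over \<open>w3\<close> leaves the Schur complement of the third diagonal entry.\<close>
  have S: "0 \<le> (cmod w1)\<^sup>2 * (ra\<^sup>2 - (cmod p1)\<^sup>2) + (cmod w2)\<^sup>2 * (rb\<^sup>2 - (cmod p2)\<^sup>2)
       + 2 * Re (cnj w1 * w2 * (x - cnj p1 * p2))" for w1 w2
  proof (cases "rc = 0")
    case True
    then show ?thesis using H'[of w1 w2 0] by (simp add: p1_def p2_def)
  next
    case False
    define w3 where "w3 = - (w1 * p1 + w2 * p2) / of_real rc"
    have w3: "of_real rc * w3 = - (w1 * p1 + w2 * p2)"
      using False by (simp add: w3_def)
    have 1: "(cmod w3)\<^sup>2 * rc\<^sup>2 = (cmod (w1 * p1 + w2 * p2))\<^sup>2"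
    proof -
      have "(cmod w3)\<^sup>2 * rc\<^sup>2 = (cmod (of_real rc * w3))\<^sup>2"
        by (simp add: norm_mult power_mult_distrib)
      then show ?thesis by (simp add: w3 norm_minus_cancel del: minus_add_distrib)
    qed
    have 2: "cnj w2 * w3 * y = - (cnj (w2 * p2) * (w1 * p1 + w2 * p2))"
    proof -
      have "cnj w2 * w3 * y = cnj (w2 * p2) * (of_real rc * w3)" by (simp add: yp)
      then show ?thesis by (simp only: w3 mult_minus_right)
    qed
    have 3: "cnj w3 * w1 * z = - (cnj (w1 * p1 + w2 * p2) * (w1 * p1))"
    proof -
      have "cnj w3 * w1 * z = cnj (of_real rc * w3) * (w1 * p1)" by (simp add: zp)
      then show ?thesis by (simp only: w3 complex_cnj_minus mult_minus_left)
    qed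
    have "(cmod w1)\<^sup>2 * (ra\<^sup>2 - (cmod p1)\<^sup>2) + (cmod w2)\<^sup>2 * (rb\<^sup>2 - (cmod p2)\<^sup>2)
       + 2 * Re (cnj w1 * w2 * (x - cnj p1 * p2))
       = (cmod w1)\<^sup>2 * ra\<^sup>2 + (cmod w2)\<^sup>2 * rb\<^sup>2 + (cmod w3)\<^sup>2 * rc\<^sup>2
       + 2 * Re (cnj w1 * w2 * x + cnj w2 * w3 * y + cnj w3 * w1 * z)"
      unfolding 1 2 3 unfolding cmod_power2 by (simp add: algebra_simps power2_eq_square)
    then show ?thesis using H'[of w1 w2 w3] by simp
  qed
  \<comment> \<open>The Schur complement has diagonal \<open>s1\<^sup>2\<close>,
    \<open>s2\<^sup>2\<close>, so \<open>x\<close> lies in the disc of radius \<open>s1 * s2\<close>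
    about \<open>cnj p1 * p2\<close>.\<close>
  define s1 where "s1 = sqrt (ra\<^sup>2 - (cmod p1)\<^sup>2)"
  define s2 where "s2 = sqrt (rb\<^sup>2 - (cmod p2)\<^sup>2)"
  have s: "s1\<^sup>2 = ra\<^sup>2 - (cmod p1)\<^sup>2" "s2\<^sup>2 = rb\<^sup>2 - (cmod p2)\<^sup>2" "0 \<le> s1" "0 \<le> s2"
    using herm2_nonneg_imp(1,2)[OF S] by (auto simp: s1_def s2_def)
  have "(cmod (x - cnj p1 * p2))\<^sup>2 \<le> (s1 * s2)\<^sup>2"
    using herm2_nonneg_imp(3)[OF S] by (simp add: power_mult_distrib s)
  then have d: "cmod (x - cnj p1 * p2) \<le> s1 * s2"
    by (rule power2_le_imp_le) (simp add: s(3,4))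
  \<comment> \<open>\<open>u\<close> is the phase of \<beta>: on that disc the real part of the
    product with \<beta> is largest at \<open>cnj p1 * p2 + s1 * s2 * cnj u\<close>.\<close>
  obtain u where u: "cmod u = 1" "\<beta> * cnj u = of_real (cmod \<beta>)"
  proof (cases "\<beta> = 0")
    case True
    then show ?thesis using that[of 1] by simp
  next
    case False
    have "cmod (sgn \<beta>) = 1" using False by (simp add: norm_sgn)
    moreover have "\<beta> * cnj (sgn \<beta>) = of_real ((cmod \<beta>)\<^sup>2 / cmod \<beta>)"
      by (simp add: sgn_eq complex_norm_square del: of_real_power)
    then have "\<beta> * cnj (sgn \<beta>) = of_real (cmod \<beta>)"
      using False by (simp add: power2_eq_square)
    ultimately show ?thesis by (rule that)
  qed
  show ?thesis
  proof (rule that)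
    show "(cmod p1)\<^sup>2 + (cmod (of_real s1 * u))\<^sup>2 = ra\<^sup>2"
      by (simp add: norm_mult u s)
    show "(cmod p2)\<^sup>2 + (cmod (of_real s2))\<^sup>2 = rb\<^sup>2" by (simp add: s)
    show "(cmod (of_real rc))\<^sup>2 + (cmod 0)\<^sup>2 = rc\<^sup>2" by simp
    have "Re (\<beta> * (x - cnj p1 * p2)) \<le> cmod (\<beta> * (x - cnj p1 * p2))"
      by (rule complex_Re_le_cmod)
    also have "\<dots> \<le> cmod \<beta> * (s1 * s2)"
      using d by (simp add: norm_mult mult_left_mono)
    also have "\<dots> = Re (\<beta> * cnj u * of_real (s1 * s2))" by (simp add: u)
    finally show "Re (\<beta> * (x + y + z)) \<le>
        Re (\<beta> * (cyc p1 p2 (of_real rc) + cyc (of_real s1 * u) (of_real s2) 0))"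
      by (simp add: cyc_def zp yp algebra_simps)
  qed
qed

section \<open>Reduction to rank one\<close>

text \<open>Surjectivity of the Hopf map from unit vectors \<open>(e, f)\<close> to the sphere. The
  common phase is free, so \<open>e\<close> may be real and positive, which determines
  \<open>f\<close>; only at the pole \<open>h = -1\<close> must \<open>e\<close> vanish.\<close>

lemma unit_with_bloch_vector:
  fixes n :: complex and h :: real
  assumes "(cmod n)\<^sup>2 + h\<^sup>2 = 1"
  obtains e f where "(cmod e)\<^sup>2 = (1 + h) / 2" "(cmod f)\<^sup>2 = (1 - h) / 2" "2 * (e * cnj f) = n"
proof (cases "h = -1")
  case True
  then have "n = 0" using assms by simp
  then show ?thesis using True that[of 0 1] by simp
next
  case False
  have "h\<^sup>2 \<le> 1\<^sup>2" using assms by (smt (verit) zero_le_power2 one_power2)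
  then have h: "1 + h > 0" using False by (auto simp: abs_square_le_1 abs_le_iff)
  define e where "e = sqrt ((1 + h) / 2)"
  have e: "e > 0" "e\<^sup>2 = (1 + h) / 2" using h by (auto simp: e_def)
  have "(cmod n)\<^sup>2 = (1 + h) * (1 - h)"
    using assms by (simp add: algebra_simps power2_eq_square)
  moreover have "(cmod (cnj n / of_real (2 * e)))\<^sup>2 = (cmod n)\<^sup>2 / (4 * e\<^sup>2)"
    by (simp add: norm_divide power_divide power_mult_distrib)
  ultimately have "(cmod (cnj n / of_real (2 * e)))\<^sup>2 = (1 + h) * (1 - h) / (4 * ((1 + h) / 2))"
    by (simp only: e(2))
  also have "\<dots> = (1 - h) / 2" using h by (simp add: divide_simps)
  finally have "(cmod (cnj n / of_real (2 * e)))\<^sup>2 = (1 - h) / 2" .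
  then show ?thesis
    using that[of "of_real e" "cnj n / of_real (2 * e)"] e by simp
qed

text \<open>Identifying a vector of \<open>\<complex>\<^sup>2\<close> with a multiple of a point of the Bloch sphere, the three given
  vectors lie in a common plane; the unit vector sought is a pole of the sphere with respect to it.\<close>

lemma equal_ratio_unit_vector:
  fixes p1 p2 p3 q1 q2 q3 :: complex
  obtains e f k where "(cmod e)\<^sup>2 + (cmod f)\<^sup>2 = 1"
    "(cmod (e * p1 + f * q1))\<^sup>2 = k * ((cmod p1)\<^sup>2 + (cmod q1)\<^sup>2)"
    "(cmod (e * p2 + f * q2))\<^sup>2 = k * ((cmod p2)\<^sup>2 + (cmod q2)\<^sup>2)"
    "(cmod (e * p3 + f * q3))\<^sup>2 = k * ((cmod p3)\<^sup>2 + (cmod q3)\<^sup>2)"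
proof -
  \<comment> \<open>Orthogonality of \<open>(n, h, m)\<close> to \<open>P p q\<close> is the
    relation \<open>rel\<close> below. Three vectors in a real space of dimension four always have
    such a nonzero normal.\<close>
  define P where "P p q = (2 * (p * cnj q), (cmod p)\<^sup>2 - (cmod q)\<^sup>2, - ((cmod p)\<^sup>2 + (cmod q)\<^sup>2))" for p q
  define S where "S = {P p1 q1, P p2 q2, P p3 q3}"
  have "dim S \<le> card S" by (rule dim_le_card') (simp add: S_def)
  also have "card S \<le> 3" unfolding S_def by (simp add: card_insert_if)
  finally have "dim S < DIM(complex \<times> real \<times> real)" by simp
  then obtain N where N0: "N \<noteq> 0" and "\<And>y. y \<in> span S \<Longrightarrow> orthogonal N y"
    using orthogonal_to_subspace_exists by blast
  then have orth: "N \<bullet> y = 0" if "y \<in> S" for y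
    using that by (simp add: span_base orthogonal_def)
  obtain n h m where N: "N = (n, h, m)" by (cases N)
  have rel: "n \<bullet> (2 * (p * cnj q)) + h * ((cmod p)\<^sup>2 - (cmod q)\<^sup>2) = m * ((cmod p)\<^sup>2 + (cmod q)\<^sup>2)"
    if "P p q \<in> S" for p q
    using orth[OF that] by (simp add: N P_def algebra_simps)
  have inS: "P p1 q1 \<in> S" "P p2 q2 \<in> S" "P p3 q3 \<in> S" by (simp_all add: S_def)
  show ?thesis
  proof (cases "n = 0 \<and> h = 0")
    case True
    then have "m \<noteq> 0" using N0 N by (auto simp: zero_prod_def)
    then have "p = 0 \<and> q = 0" if "P p q \<in> S" for p q
      using rel[OF that] True by (simp add: sum_power2_eq_zero_iff)
    then show ?thesis using inS that[of 1 0 0] by simp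
  next
    case False
    define r where "r = sqrt ((cmod n)\<^sup>2 + h\<^sup>2)"
    have "(cmod n)\<^sup>2 + h\<^sup>2 > 0" using False
      by (simp add: sum_power2_gt_zero_iff)
    then have r: "r > 0" "r\<^sup>2 = (cmod n)\<^sup>2 + h\<^sup>2" by (auto simp: r_def)
    \<comment> \<open>The conjugate appears because \<open>n \<bullet> z = Re (cnj n * z)\<close>,
      while the cross term of \<open>|e * p + f * q|^2\<close> is
      \<open>Re (2 * (e * cnj f) * (p * cnj q))\<close>.\<close>
    have "(cmod (cnj n / of_real r))\<^sup>2 + (h / r)\<^sup>2 = ((cmod n)\<^sup>2 + h\<^sup>2) / r\<^sup>2"
      by (simp add: norm_divide power_divide add_divide_distrib)
    also have "\<dots> = 1" using r by (metis div_self less_irrefl zero_less_power)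
    finally obtain e f where ef: "(cmod e)\<^sup>2 = (1 + h / r) / 2" "(cmod f)\<^sup>2 = (1 - h / r) / 2"
        "2 * (e * cnj f) = cnj n / of_real r"
      by (rule unit_with_bloch_vector)
    have main: "(cmod (e * p + f * q))\<^sup>2 = (1 + m / r) / 2 * ((cmod p)\<^sup>2 + (cmod q)\<^sup>2)"
      if "P p q \<in> S" for p q
    proof -
      have "(cmod (e * p + f * q))\<^sup>2 = (cmod e)\<^sup>2 * (cmod p)\<^sup>2 + (cmod f)\<^sup>2 * (cmod q)\<^sup>2
          + Re (2 * (e * cnj f) * (p * cnj q))"
        unfolding cmod_power2 by (simp add: algebra_simps power2_eq_square)
      also have "Re (2 * (e * cnj f) * (p * cnj q)) = (n \<bullet> (2 * (p * cnj q))) / r / 2"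
        unfolding ef(3) using r(1) by (simp add: inner_complex_def divide_simps) (simp add: algebra_simps)
      also have "n \<bullet> (2 * (p * cnj q)) = m * ((cmod p)\<^sup>2 + (cmod q)\<^sup>2) - h * ((cmod p)\<^sup>2 - (cmod q)\<^sup>2)"
        using rel[OF that] by simp
      finally show ?thesis
        unfolding ef(1,2) by (simp add: add_divide_distrib diff_divide_distrib algebra_simps)
    qed
    have "(cmod e)\<^sup>2 + (cmod f)\<^sup>2 = 1" by (simp add: ef field_simps)
    then show ?thesis using that main inS by blast
  qed
qed

text \<open>The row \<open>(cnj f, - cnj e)\<close> completes \<open>(e, f)\<close> to a unitary
  matrix, which preserves the Hermitian products \<open>cnj p * p' + cnj q * q'\<close>.\<close>

lemma cyc_unitary:
  assumes "(cmod e)\<^sup>2 + (cmod f)\<^sup>2 = 1"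
  shows "cyc (e * p1 + f * q1) (e * p2 + f * q2) (e * p3 + f * q3)
       + cyc (cnj f * p1 - cnj e * q1) (cnj f * p2 - cnj e * q2) (cnj f * p3 - cnj e * q3)
       = cyc p1 p2 p3 + cyc q1 q2 q3"
proof -
  have 1: "e * cnj e + f * cnj f = 1"
    using assms by (metis complex_norm_square of_real_1 of_real_add)
  have "cnj (e * p + f * q) * (e * p' + f * q') + cnj (cnj f * p - cnj e * q) * (cnj f * p' - cnj e * q')
     = (e * cnj e + f * cnj f) * (cnj p * p' + cnj q * q')" for p q p' q'
    by (simp add: algebra_simps)
  then have *: "cnj (e * p + f * q) * (e * p' + f * q') + cnj (cnj f * p - cnj e * q) * (cnj f * p' - cnj e * q')
     = cnj p * p' + cnj q * q'" for p q p' q'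
    by (simp add: 1)
  show ?thesis
    unfolding cyc_def
    using *[of p1 q1 p2 q2] *[of p2 q2 p3 q3] *[of p3 q3 p1 q1] by algebra
qed

lemma cmod_unitary:
  assumes "(cmod e)\<^sup>2 + (cmod f)\<^sup>2 = 1"
  shows "(cmod (e * p + f * q))\<^sup>2 + (cmod (cnj f * p - cnj e * q))\<^sup>2 = (cmod p)\<^sup>2 + (cmod q)\<^sup>2"
proof -
  have "(cmod (e * p + f * q))\<^sup>2 + (cmod (cnj f * p - cnj e * q))\<^sup>2
     = ((cmod e)\<^sup>2 + (cmod f)\<^sup>2) * ((cmod p)\<^sup>2 + (cmod q)\<^sup>2)"
    unfolding cmod_power2 by (simp add: algebra_simps power2_eq_square)
  then show ?thesis by (simp add: assms)
qed

text \<open>\<open>cyc\<close> is homogeneous of degree two, so division by \<open>sqrt k\<close>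
  leads back to the moduli in \<open>G\<close>; for \<open>k = 0\<close> all three numbers
  vanish.\<close>

lemma cyc_bound_scale:
  assumes G: "\<And>z1 z2 z3. cmod z1 = ra \<Longrightarrow> cmod z2 = rb \<Longrightarrow> cmod z3 = rc \<Longrightarrow> Re (\<beta> * cyc z1 z2 z3) \<le> G"
    and r: "0 \<le> ra" "0 \<le> rb" "0 \<le> rc" and k: "0 \<le> k"
    and a: "(cmod a1)\<^sup>2 = k * ra\<^sup>2" "(cmod a2)\<^sup>2 = k * rb\<^sup>2" "(cmod a3)\<^sup>2 = k * rc\<^sup>2"
  shows "Re (\<beta> * cyc a1 a2 a3) \<le> k * G"
proof (cases "k = 0")
  case True
  then show ?thesis using a by (simp add: cyc_def)
next
  case False
  then have k: "k > 0" using k by simp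
  define t where "t = sqrt k"
  have t: "t > 0" "t\<^sup>2 = k" using k by (auto simp: t_def)
  have n: "cmod ((1 / t) *\<^sub>R w) = \<rho>" if "(cmod w)\<^sup>2 = k * \<rho>\<^sup>2" "0 \<le> \<rho>" for w \<rho>
  proof -
    have "(cmod w)\<^sup>2 = (t * \<rho>)\<^sup>2" using that t by (simp add: power_mult_distrib)
    then have "cmod w = t * \<rho>" using t that by (simp add: power2_eq_iff_nonneg)
    then show ?thesis using t by simp
  qed
  have "Re (\<beta> * cyc ((1 / t) *\<^sub>R a1) ((1 / t) *\<^sub>R a2) ((1 / t) *\<^sub>R a3)) \<le> G"
    using n a r by (intro G) auto
  then show ?thesis
    unfolding cyc_scaleR using t k by (simp add: power_divide field_simps)
qed

text \<open>After a unitary change of basis the first coordinates carry the share \<open>k\<close>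
  of every squared radius and the second ones \<open>1 - k\<close>, so the scaled bounds add up to
  \<open>G\<close>.\<close>

lemma cyc_bound_rank_two:
  assumes G: "\<And>z1 z2 z3. cmod z1 = ra \<Longrightarrow> cmod z2 = rb \<Longrightarrow> cmod z3 = rc \<Longrightarrow> Re (\<beta> * cyc z1 z2 z3) \<le> G"
    and r: "0 \<le> ra" "0 \<le> rb" "0 \<le> rc"
    and pq: "(cmod p1)\<^sup>2 + (cmod q1)\<^sup>2 = ra\<^sup>2" "(cmod p2)\<^sup>2 + (cmod q2)\<^sup>2 = rb\<^sup>2"
      "(cmod p3)\<^sup>2 + (cmod q3)\<^sup>2 = rc\<^sup>2"
  shows "Re (\<beta> * (cyc p1 p2 p3 + cyc q1 q2 q3)) \<le> G"
proof (cases "ra = 0 \<and> rb = 0 \<and> rc = 0")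
  case True
  then show ?thesis
    using pq G[of 0 0 0] by (simp add: sum_power2_eq_zero_iff cyc_def)
next
  case False
  obtain e f k where ef: "(cmod e)\<^sup>2 + (cmod f)\<^sup>2 = 1"
    and a: "(cmod (e * p1 + f * q1))\<^sup>2 = k * ra\<^sup>2" "(cmod (e * p2 + f * q2))\<^sup>2 = k * rb\<^sup>2"
      "(cmod (e * p3 + f * q3))\<^sup>2 = k * rc\<^sup>2"
    using equal_ratio_unit_vector[of p1 q1 p2 q2 p3 q3] unfolding pq by metis
  have b: "(cmod (cnj f * p1 - cnj e * q1))\<^sup>2 = (1 - k) * ra\<^sup>2"
    "(cmod (cnj f * p2 - cnj e * q2))\<^sup>2 = (1 - k) * rb\<^sup>2"
    "(cmod (cnj f * p3 - cnj e * q3))\<^sup>2 = (1 - k) * rc\<^sup>2"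
    using a pq cmod_unitary[OF ef, of p1 q1] cmod_unitary[OF ef, of p2 q2] cmod_unitary[OF ef, of p3 q3]
    by (simp_all add: algebra_simps)
  \<comment> \<open>Some radius is nonzero, so the sign of \<open>t\<close> can be read off. This
    confines \<open>k\<close> to [0, 1] and is why the case of three zero radii is split
    off.\<close>
  have nonneg: "0 \<le> t" if "0 \<le> t * ra\<^sup>2" "0 \<le> t * rb\<^sup>2" "0 \<le> t * rc\<^sup>2" for t
    using that False by (auto simp: zero_le_mult_iff)
  have "0 \<le> k" by (rule nonneg) (simp_all only: a[symmetric] zero_le_power2)
  moreover have "0 \<le> 1 - k" by (rule nonneg) (simp_all only: b[symmetric] zero_le_power2)
  ultimately have k: "0 \<le> k" "0 \<le> 1 - k" .
  let ?a = "cyc (e * p1 + f * q1) (e * p2 + f * q2) (e * p3 + f * q3)"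
  let ?b = "cyc (cnj f * p1 - cnj e * q1) (cnj f * p2 - cnj e * q2) (cnj f * p3 - cnj e * q3)"
  have "Re (\<beta> * (cyc p1 p2 p3 + cyc q1 q2 q3)) = Re (\<beta> * ?a) + Re (\<beta> * ?b)"
    by (subst cyc_unitary[OF ef, symmetric]) (simp only: distrib_left plus_complex.sel)
  also have "\<dots> \<le> k * G + (1 - k) * G"
    by (rule add_mono[OF cyc_bound_scale[OF G r k(1) a] cyc_bound_scale[OF G r k(2) b]])
  finally show ?thesis by (simp add: algebra_simps)
qed

section \<open>Exactness\<close>

lemma cyc_attains_max:
  assumes "0 \<le> ra" "0 \<le> rb" "0 \<le> rc"
  obtains z1 z2 z3 where "cmod z1 = ra" "cmod z2 = rb" "cmod z3 = rc"
    "\<And>w1 w2 w3. cmod w1 = ra \<Longrightarrow> cmod w2 = rb \<Longrightarrow> cmod w3 = rc \<Longrightarrow>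
       Re (\<beta> * cyc w1 w2 w3) \<le> Re (\<beta> * cyc z1 z2 z3)"
proof -
  let ?S = "sphere (0::complex) ra \<times> sphere (0::complex) rb \<times> sphere (0::complex) rc"
  have "compact ?S" by (intro compact_Times compact_sphere)
  moreover have "(of_real ra, of_real rb, of_real rc) \<in> ?S" using assms by simp
  then have "?S \<noteq> {}" by blast
  moreover have "continuous_on ?S (\<lambda>s. Re (\<beta> * cyc (fst s) (fst (snd s)) (snd (snd s))))"
    unfolding cyc_def by (intro continuous_intros)
  ultimately obtain s where s: "s \<in> ?S"
    and max: "\<And>t. t \<in> ?S \<Longrightarrow> Re (\<beta> * cyc (fst t) (fst (snd t)) (snd (snd t)))
      \<le> Re (\<beta> * cyc (fst s) (fst (snd s)) (snd (snd s)))"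
    by (metis (no_types, lifting) continuous_attains_sup)
  show ?thesis
  proof (rule that)
    show "cmod (fst s) = ra" "cmod (fst (snd s)) = rb" "cmod (snd (snd s)) = rc"
      using s by auto
    show "Re (\<beta> * cyc w1 w2 w3) \<le> Re (\<beta> * cyc (fst s) (fst (snd s)) (snd (snd s)))"
      if "cmod w1 = ra" "cmod w2 = rb" "cmod w3 = rc" for w1 w2 w3
      using max[of "(w1, w2, w3)"] that by simp
  qed
qed

theorem mainTheorem3:
  fixes lam b1 b2 ra rb rc :: real
  assumes "0 \<le> ra" and "0 \<le> rb" and "0 \<le> rc"
  shows "\<exists>v. is_max_value (\<lambda>x. x \<bullet> (A_mat lam b1 b2 *v x)) (qcqp_feasible ra rb rc) v \<and>
             is_max_value (\<lambda>X. trace (A_mat lam b1 b2 ** X)) (sdp_feasible ra rb rc) v"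
proof -
  let ?\<beta> = "Complex b1 b2"
  obtain z1 z2 z3 where z: "cmod z1 = ra" "cmod z2 = rb" "cmod z3 = rc"
    and max: "\<And>w1 w2 w3. cmod w1 = ra \<Longrightarrow> cmod w2 = rb \<Longrightarrow> cmod w3 = rc \<Longrightarrow>
       Re (?\<beta> * cyc w1 w2 w3) \<le> Re (?\<beta> * cyc z1 z2 z3)"
    using cyc_attains_max[OF assms] by metis
  define v where "v = lam * (ra\<^sup>2 + rb\<^sup>2 + rc\<^sup>2) + 2 * Re (?\<beta> * cyc z1 z2 z3)"
  obtain a b c where abc: "cplx a = z1" "cplx b = z2" "cplx c = z3"
    using surj_cplx by (metis surj_def)
  then have norms: "norm a = ra" "norm b = rb" "norm c = rc"
    using z norm_cplx by metis+
  define x where "x = stack3 a b c"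
  have x: "x \<in> qcqp_feasible ra rb rc"
    unfolding qcqp_feasible_def x_def using norms by auto
  have xv: "x \<bullet> (A_mat lam b1 b2 *v x) = v"
    unfolding x_def quadratic_form_A_mat by (simp add: norms abc v_def)
  have le: "trace (A_mat lam b1 b2 ** X) \<le> v" if "X \<in> sdp_feasible ra rb rc" for X
  proof -
    have X: "X$1$1 + X$2$2 = ra\<^sup>2" "X$3$3 + X$4$4 = rb\<^sup>2" "X$5$5 + X$6$6 = rc\<^sup>2" "psd X"
      using that by (auto simp: sdp_feasible_def)
    obtain p1 p2 p3 q1 q2 q3 where
      pq: "(cmod p1)\<^sup>2 + (cmod q1)\<^sup>2 = ra\<^sup>2" "(cmod p2)\<^sup>2 + (cmod q2)\<^sup>2 = rb\<^sup>2"
        "(cmod p3)\<^sup>2 + (cmod q3)\<^sup>2 = rc\<^sup>2"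
      and "Re (?\<beta> * (hab X + hbc X + hca X)) \<le> Re (?\<beta> * (cyc p1 p2 p3 + cyc q1 q2 q3))"
      by (rule herm_nonneg_rank_two[OF psd_imp_herm_nonneg[OF X(4), unfolded X(1-3)]])
    note this(4)
    also have "Re (?\<beta> * (cyc p1 p2 p3 + cyc q1 q2 q3)) \<le> Re (?\<beta> * cyc z1 z2 z3)"
      using max assms pq by (rule cyc_bound_rank_two)
    finally have "Re (?\<beta> * (hab X + hbc X + hca X)) \<le> Re (?\<beta> * cyc z1 z2 z3)" .
    then show ?thesis
      using X by (simp add: trace_A_mat psd_def v_def)
  qed
  have "is_max_value (\<lambda>X. trace (A_mat lam b1 b2 ** X)) (sdp_feasible ra rb rc) v"
    unfolding is_max_value_def using le outer_sdp_feasible[OF x] trace_outer xv by metis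
  \<comment> \<open>A feasible point of the program has the objective value of its
    \<open>outer\<close> matrix, so it inherits the bound \<open>le\<close>.\<close>
  moreover have "is_max_value (\<lambda>x. x \<bullet> (A_mat lam b1 b2 *v x)) (qcqp_feasible ra rb rc) v"
    unfolding is_max_value_def using x xv le outer_sdp_feasible trace_outer by metis
  ultimately show ?thesis by blast
qed

end
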